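(* Every existential formula is concise in the class of torsion-free locally class-$2$ nilpotent groups. That is, if $\varphi$ is an existential formula and $G$ is a torsion-free locally class-$2$ nilpotent group such that $G_\varphi$ is finite, then $\varphi(G)=\langle G_\varphi\rangle$ is finite.
   Context: A formula means a first-order formula with exactly one free variable in the language of groups, without parameters. It is existential if it is logically equivalent to a formula in prenex form $\exists x_1,\dots,x_n\colon b(w_1(\underline x,y)=1,\dots,w_m(\underline x,y)=1)$ with only existential quantifiers, where $b$ is a boolean combination (negations allowed) and the $w_i$ are group words. For a formula $\varphi$ and a group $G$, put $G_\varphi=\{g\in G\mid \varphi(g)\text{ is true in }G\}$ and $\varphi(G)=\langle G_\varphi\rangle$. A formula $\varphi$ is concise in a class of groups $\mathcal C$ if for all $G\in\mathcal C$, $|G_\varphi|<\infty$ implies $|\varphi(G)|<\infty$. A group is locally class-$2$ nilpotent if every finitely generated subgroup is nilpotent of class at most $2$. *)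

theory Defs
  imports "HOL-Algebra.Generated_Groups"
begin

datatype gterm =
    Var nat
  | One
  | Mult gterm gterm
  | Inv gterm

datatype gform =
    Eq gterm gterm
  | Neg gform
  | Conj gform gform
  | Disj gform gform
  | Ex nat gform
  | All nat gform

fun tvars :: "gterm \<Rightarrow> nat set" where
  "tvars (Var i) = {i}"
| "tvars One = {}"
| "tvars (Mult s t) = tvars s \<union> tvars t"
| "tvars (Inv t) = tvars t"

fun fvars :: "gform \<Rightarrow> nat set" where
  "fvars (Eq s t) = tvars s \<union> tvars t"
| "fvars (Neg p) = fvars p"
| "fvars (Conj p q) = fvars p \<union> fvars q"
| "fvars (Disj p q) = fvars p \<union> fvars q"
| "fvars (Ex i p) = fvars p - {i}"
| "fvars (All i p) = fvars p - {i}"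

definition one_free_var :: "gform \<Rightarrow> bool" where
  "one_free_var p \<longleftrightarrow> (\<exists>y. fvars p = {y})"

fun tval :: "('a, 'b) monoid_scheme \<Rightarrow> (nat \<Rightarrow> 'a) \<Rightarrow> gterm \<Rightarrow> 'a" where
  "tval G e (Var i) = e i"
| "tval G e One = \<one>\<^bsub>G\<^esub>"
| "tval G e (Mult s t) = tval G e s \<otimes>\<^bsub>G\<^esub> tval G e t"
| "tval G e (Inv t) = inv\<^bsub>G\<^esub> (tval G e t)"

fun sat :: "('a, 'b) monoid_scheme \<Rightarrow> (nat \<Rightarrow> 'a) \<Rightarrow> gform \<Rightarrow> bool" where
  "sat G e (Eq s t) \<longleftrightarrow> tval G e s = tval G e t"
| "sat G e (Neg p) \<longleftrightarrow> \<not> sat G e p"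
| "sat G e (Conj p q) \<longleftrightarrow> sat G e p \<and> sat G e q"
| "sat G e (Disj p q) \<longleftrightarrow> sat G e p \<or> sat G e q"
| "sat G e (Ex i p) \<longleftrightarrow> (\<exists>a\<in>carrier G. sat G (e(i := a)) p)"
| "sat G e (All i p) \<longleftrightarrow> (\<forall>a\<in>carrier G. sat G (e(i := a)) p)"

text \<open>
  Logical equivalence is equivalence in all groups. A definition in HOL cannot quantify over
  all types, so the groups here are those whose carrier is a set of elements of a given type
  \<open>'a\<close>. If \<open>'a\<close> is infinite, nothing is lost: by the downward Loewenheim-Skolem theorem, two
  formulas that differ in some group differ in a countable one, and that has a copy inside
  \<open>'a\<close>. In general, equivalence in all groups implies equivalence over \<open>'a\<close>.
\<close>

definition logically_equivalent :: "'a itself \<Rightarrow> gform \<Rightarrow> gform \<Rightarrow> bool" where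
  "logically_equivalent (_ :: 'a itself) p q \<longleftrightarrow>
     (\<forall>(G :: 'a monoid) e. group G \<longrightarrow> range e \<subseteq> carrier G \<longrightarrow> (sat G e p \<longleftrightarrow> sat G e q))"

text \<open>Boolean combinations of equations \<open>w = 1\<close>; the terms \<open>w\<close> play the role of group words.\<close>

fun word_matrix :: "gform \<Rightarrow> bool" where
  "word_matrix (Eq w t) \<longleftrightarrow> t = One"
| "word_matrix (Neg p) \<longleftrightarrow> word_matrix p"
| "word_matrix (Conj p q) \<longleftrightarrow> word_matrix p \<and> word_matrix q"
| "word_matrix (Disj p q) \<longleftrightarrow> word_matrix p \<and> word_matrix q"
| "word_matrix (Ex i p) \<longleftrightarrow> False"
| "word_matrix (All i p) \<longleftrightarrow> False"

definition existential_prenex :: "gform \<Rightarrow> bool" where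
  "existential_prenex p \<longleftrightarrow> (\<exists>xs b. word_matrix b \<and> p = foldr Ex xs b)"

definition existential :: "'a itself \<Rightarrow> gform \<Rightarrow> bool" where
  "existential (T :: 'a itself) p \<longleftrightarrow>
     (\<exists>q. existential_prenex q \<and> fvars q = fvars p \<and> logically_equivalent T p q)"

text \<open>
  Under the constant assignment \<open>\<lambda>_. g\<close>, the only free variable of \<open>p\<close>, whatever its name,
  has the value \<open>g\<close>; the values of the other variables are irrelevant.
\<close>

definition solutions :: "('a, 'b) monoid_scheme \<Rightarrow> gform \<Rightarrow> 'a set" where
  "solutions G p = {g \<in> carrier G. sat G (\<lambda>_. g) p}"

definition formula_subgroup :: "('a, 'b) monoid_scheme \<Rightarrow> gform \<Rightarrow> 'a set" where
  "formula_subgroup G p = generate G (solutions G p)"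

definition concise_in :: "('a, 'b) monoid_scheme set \<Rightarrow> gform \<Rightarrow> bool" where
  "concise_in \<C> p \<longleftrightarrow>
     (\<forall>G\<in>\<C>. finite (solutions G p) \<longrightarrow> finite (formula_subgroup G p))"

definition torsion_free :: "('a, 'b) monoid_scheme \<Rightarrow> bool" where
  "torsion_free G \<longleftrightarrow>
     (\<forall>g\<in>carrier G. \<forall>n::nat. n > 0 \<longrightarrow> g [^]\<^bsub>G\<^esub> n = \<one>\<^bsub>G\<^esub> \<longrightarrow> g = \<one>\<^bsub>G\<^esub>)"

definition commutator :: "('a, 'b) monoid_scheme \<Rightarrow> 'a \<Rightarrow> 'a \<Rightarrow> 'a" where
  "commutator G a b = inv\<^bsub>G\<^esub> a \<otimes>\<^bsub>G\<^esub> inv\<^bsub>G\<^esub> b \<otimes>\<^bsub>G\<^esub> a \<otimes>\<^bsub>G\<^esub> b"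

text \<open>Indices start at 0: \<open>lower_central G i\<close> is what is usually written $\gamma_{i+1}(G)$.\<close>

fun lower_central :: "('a, 'b) monoid_scheme \<Rightarrow> nat \<Rightarrow> 'a set" where
  "lower_central G 0 = carrier G"
| "lower_central G (Suc i) =
     generate G {commutator G a b | a b. a \<in> lower_central G i \<and> b \<in> carrier G}"

definition nilpotent_class_le :: "('a, 'b) monoid_scheme \<Rightarrow> nat \<Rightarrow> bool" where
  "nilpotent_class_le G c \<longleftrightarrow> lower_central G c = {\<one>\<^bsub>G\<^esub>}"

definition locally_class2_nilpotent :: "('a, 'b) monoid_scheme \<Rightarrow> bool" where
  "locally_class2_nilpotent G \<longleftrightarrow>
     (\<forall>S. finite S \<longrightarrow> S \<subseteq> carrier G \<longrightarrow>
        nilpotent_class_le (G\<lparr>carrier := generate G S\<rparr>) 2)"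

end

theory Submission
  imports Defs "HOL-Algebra.Elementary_Groups"
begin

text \<open>
  Let \<open>Z\<close> be the centre of \<open>G\<close> and \<open>g \<noteq> 1\<close> a solution, with witnesses \<open>x\<^sub>1, \<dots>, x\<^sub>n\<close> for the
  existential quantifiers. Rationally, a class-2 nilpotent group is a direct sum of its centre and
  a complement, and multiplication by \<open>t\<close> on the complement and \<open>t\<^sup>2\<close> on the centre respects the group
  law. An integral form of this dilation, for infinitely many \<open>t\<close>, is an injective homomorphism on a
  subgroup containing \<open>Z\<close>, \<open>g\<close> and the \<open>x\<^sub>i\<close>. It preserves equations and inequations, so it maps
  \<open>g\<close> to another solution; by torsion-freeness these images are pairwise distinct. Hence a finite
  solution set contains at most the identity.
\<close>

section \<open>Centre and commutator calculus in groups of class at most 2\<close>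

definition centre :: "('a, 'b) monoid_scheme \<Rightarrow> 'a set" where
  "centre G = {z \<in> carrier G. \<forall>x\<in>carrier G. x \<otimes>\<^bsub>G\<^esub> z = z \<otimes>\<^bsub>G\<^esub> x}"

locale class2_group = group G for G (structure) +
  assumes commutator_in_centre:
    "\<lbrakk>x \<in> carrier G; y \<in> carrier G\<rbrakk> \<Longrightarrow> commutator G x y \<in> centre G"
begin

abbreviation com :: "'a \<Rightarrow> 'a \<Rightarrow> 'a" where "com \<equiv> commutator G"
abbreviation Z :: "'a set" where "Z \<equiv> centre G"

lemma Z_carrier [simp]: "z \<in> Z \<Longrightarrow> z \<in> carrier G"
  by (simp add: centre_def)

lemma Z_comm: "\<lbrakk>z \<in> Z; x \<in> carrier G\<rbrakk> \<Longrightarrow> x \<otimes> z = z \<otimes> x"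
  unfolding centre_def by blast

lemma Z_lcomm: "\<lbrakk>z \<in> Z; x \<in> carrier G; y \<in> carrier G\<rbrakk> \<Longrightarrow> x \<otimes> (z \<otimes> y) = z \<otimes> (x \<otimes> y)"
  by (metis Z_carrier Z_comm m_assoc)

lemma cancel_inv [simp]:
  assumes "x \<in> carrier G" "y \<in> carrier G"
  shows "inv x \<otimes> (x \<otimes> y) = y" "x \<otimes> (inv x \<otimes> y) = y"
  using assms by (simp_all flip: m_assoc)

lemma subgroup_Z: "subgroup Z G"
proof (rule subgroupI)
  have "\<one> \<in> Z" by (simp add: centre_def del: Z_carrier)
  then show "Z \<noteq> {}" by blast
next
  fix z assume z: "z \<in> Z"
  show "inv z \<in> Z"
    unfolding centre_def
  proof (intro CollectI conjI ballI)
    fix x assume x: "x \<in> carrier G"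
    have "inv z \<otimes> (x \<otimes> z) \<otimes> inv z = inv z \<otimes> (z \<otimes> x) \<otimes> inv z"
      using Z_comm[OF z x] by simp
    then show "x \<otimes> inv z = inv z \<otimes> x"
      using x Z_carrier[OF z] by (simp add: m_assoc)
  qed (use z in simp)
next
  fix z w assume zw: "z \<in> Z" "w \<in> Z"
  have "x \<otimes> (z \<otimes> w) = z \<otimes> w \<otimes> x" if x: "x \<in> carrier G" for x
    using x zw Z_lcomm[OF zw(1) x, of w] Z_comm[OF zw(2) x] by (simp add: m_assoc)
  then show "z \<otimes> w \<in> Z"
    using zw Z_carrier unfolding centre_def by blast
qed (use Z_carrier in blast)

lemma Z_closed [simp, intro]:
  "\<one> \<in> Z" "\<lbrakk>z \<in> Z; w \<in> Z\<rbrakk> \<Longrightarrow> z \<otimes> w \<in> Z" "z \<in> Z \<Longrightarrow> z [^] (i::int) \<in> Z"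
  using subgroup_Z subgroup.one_closed subgroup.m_closed subgroup_int_pow_closed by metis+

lemma commutator_in_Z [simp, intro]: "\<lbrakk>x \<in> carrier G; y \<in> carrier G\<rbrakk> \<Longrightarrow> com x y \<in> Z"
  by (rule commutator_in_centre)

lemma int_pow_distrib_Z:
  assumes "x \<in> carrier G" "z \<in> Z"
  shows "(x \<otimes> z) [^] (i::int) = x [^] i \<otimes> z [^] i"
  by (rule int_pow_mult_distrib) (use assms Z_comm[of z x] in auto)

lemma commutator_swap: "\<lbrakk>x \<in> carrier G; y \<in> carrier G\<rbrakk> \<Longrightarrow> x \<otimes> y = y \<otimes> x \<otimes> com x y"
  unfolding commutator_def by (simp add: m_assoc)

lemma commutator_eqI:
  assumes "x \<in> carrier G" "y \<in> carrier G" "c \<in> carrier G" "x \<otimes> y = y \<otimes> x \<otimes> c"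
  shows "com x y = c"
  using commutator_swap[of x y] assms by simp

text \<open>Commutators are central, so the one left by moving \<open>z\<close> past
  \<open>y\<close> can be pulled out before \<open>z\<close> moves past \<open>x\<close>. With its
  mirror image this makes \<open>com\<close> bilinear.\<close>

lemma commutator_mult_left:
  assumes x: "x \<in> carrier G" and y: "y \<in> carrier G" and z: "z \<in> carrier G"
  shows "com (x \<otimes> y) z = com x z \<otimes> com y z"
proof (rule commutator_eqI)
  have "x \<otimes> y \<otimes> z = x \<otimes> z \<otimes> y \<otimes> com y z"
    using assms commutator_swap[OF y z] by (simp add: m_assoc)
  also have "\<dots> = z \<otimes> x \<otimes> com x z \<otimes> y \<otimes> com y z"
    using assms commutator_swap[OF x z] by simp
  also have "\<dots> = z \<otimes> (x \<otimes> y) \<otimes> (com x z \<otimes> com y z)"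
    using assms Z_lcomm[of "com x z" y "com y z"] by (simp add: m_assoc)
  finally show "x \<otimes> y \<otimes> z = z \<otimes> (x \<otimes> y) \<otimes> (com x z \<otimes> com y z)" .
qed (use assms in auto)

lemma commutator_Z_left [simp]: "\<lbrakk>z \<in> Z; x \<in> carrier G\<rbrakk> \<Longrightarrow> com z x = \<one>"
  using Z_comm[of z x] by (intro commutator_eqI) auto

lemma commutator_self [simp]: "x \<in> carrier G \<Longrightarrow> com x x = \<one>"
  by (rule commutator_eqI) auto

lemma commutator_sym:
  assumes "x \<in> carrier G" "y \<in> carrier G"
  shows "com y x = inv com x y"
proof (rule commutator_eqI)
  show "y \<otimes> x = x \<otimes> y \<otimes> inv com x y"
    using assms commutator_swap[OF assms] by (simp add: m_assoc)
qed (use assms in auto)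

lemma group_hom_commutator_left: "y \<in> carrier G \<Longrightarrow> group_hom G G (\<lambda>x. com x y)"
  by unfold_locales (auto simp: hom_def commutator_mult_left)

lemma commutator_int_pow_left:
  "\<lbrakk>x \<in> carrier G; y \<in> carrier G\<rbrakk> \<Longrightarrow> com (x [^] (i::int)) y = com x y [^] i"
  using group_hom.hom_int_pow[OF group_hom_commutator_left] by simp

lemma commutator_int_pow_right:
  "\<lbrakk>x \<in> carrier G; y \<in> carrier G\<rbrakk> \<Longrightarrow> com x (y [^] (i::int)) = com x y [^] i"
  by (metis (no_types, opaque_lifting) commutator_int_pow_left commutator_sym commutator_in_Z Z_carrier int_pow_closed int_pow_inv inv_inv)

lemma commutator_mult_right:
  assumes "x \<in> carrier G" "y \<in> carrier G" "z \<in> carrier G"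
  shows "com x (y \<otimes> z) = com x y \<otimes> com x z"
proof -
  have "com x (y \<otimes> z) = inv (com y x \<otimes> com z x)"
    using assms commutator_sym[of "y \<otimes> z" x] by (simp add: commutator_mult_left)
  also have "\<dots> = inv com y x \<otimes> inv com z x"
    using assms Z_comm[of "com z x" "com y x"] by (simp add: inv_mult_group)
  finally show ?thesis
    using assms by (simp flip: commutator_sym)
qed

text \<open>Collect all copies of \<open>x\<close> on the left: the i-th one passes i - 1 copies of
  \<open>y\<close>, and each passage leaves one central factor \<open>com y x\<close>.\<close>

lemma power_mult_class2:
  assumes x: "x \<in> carrier G" and y: "y \<in> carrier G"
  shows "(x \<otimes> y) [^] int n = x [^] int n \<otimes> y [^] int n \<otimes> com y x [^] int (n * (n - 1) div 2)"
proof (induction n)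
  case 0
  then show ?case using assms by (simp add: int_pow_int)
next
  case (Suc n)
  define T where "T = int (n * (n - 1) div 2)"
  have T: "int (Suc n * (Suc n - 1) div 2) = int n + T"
  proof -
    have "Suc n * n = n * (n - 1) + n * 2" by (cases n) auto
    then have "Suc n * n div 2 = n * (n - 1) div 2 + n" by simp
    then show ?thesis unfolding T_def by simp
  qed
  have S: "u [^] int (Suc n) = u [^] int n \<otimes> u" if "u \<in> carrier G" for u
    using that int_pow_int[of G u "Suc n"] by (simp add: int_pow_int)
  let ?X = "x [^] int n" and ?Y = "y [^] int n" and ?c = "com y x"
  have "(x \<otimes> y) [^] int (Suc n) = ?X \<otimes> ?Y \<otimes> ?c [^] T \<otimes> (x \<otimes> y)"
    using Suc.IH assms by (simp add: S T_def del: of_nat_Suc)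
  also have "\<dots> = ?X \<otimes> (?Y \<otimes> x) \<otimes> y \<otimes> ?c [^] T"
    using assms Z_comm[of "?c [^] T" "x \<otimes> y"] by (simp add: m_assoc)
  also have "?Y \<otimes> x = x \<otimes> ?Y \<otimes> ?c [^] int n"
    using assms commutator_swap[of ?Y x] commutator_int_pow_left by simp
  also have "?X \<otimes> (x \<otimes> ?Y \<otimes> ?c [^] int n) \<otimes> y \<otimes> ?c [^] T
      = (?X \<otimes> x) \<otimes> (?Y \<otimes> y) \<otimes> (?c [^] int n \<otimes> ?c [^] T)"
    using assms Z_lcomm[of "?c [^] int n" y "?c [^] T"] by (simp add: m_assoc)
  finally show ?case
    using assms by (simp only: S T int_pow_mult commutator_in_Z Z_carrier)
qed

section \<open>Logarithms with values in the centre\<close>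

text \<open>
  Twice \<open>m\<close> times the logarithm, projected to the centre along a complement: the correction term is
  that of the Baker-Campbell-Hausdorff formula, and the factor \<open>2 m\<close> clears its denominator and
  those of the projection.
\<close>

definition centre_log :: "'a set \<Rightarrow> int \<Rightarrow> ('a \<Rightarrow> 'a) \<Rightarrow> bool" where
  "centre_log K m p \<longleftrightarrow>
     subgroup K G \<and> Z \<subseteq> K \<and> m > 0 \<and> p ` K \<subseteq> Z \<and>
     (\<forall>x\<in>K. \<forall>y\<in>K. p (x \<otimes> y) = p x \<otimes> p y \<otimes> com x y [^] m) \<and>
     (\<forall>z\<in>Z. p z = z [^] (2 * m))"

text \<open>Start of the induction in \<open>centre_log_finite\<close>: on the abelian group
  \<open>Z\<close> the projection is the identity, and only the factor 2 remains.\<close>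

lemma centre_log_Z: "centre_log Z 1 (\<lambda>z. z [^] (2::int))"
  using subgroup_Z by (auto simp: centre_log_def int_pow_distrib_Z)

text \<open>Powers of \<open>x\<close> commute, so the commutator term vanishes and \<open>p\<close>
  is a homomorphism on the cyclic group they form.\<close>

lemma centre_log_int_pow:
  assumes "centre_log K m p" "x \<in> K"
  shows "p (x [^] (i::int)) = p x [^] i"
proof -
  have K: "subgroup K G" and pZ: "\<And>y. y \<in> K \<Longrightarrow> p y \<in> Z"
    and p: "\<And>y z. \<lbrakk>y \<in> K; z \<in> K\<rbrakk> \<Longrightarrow> p (y \<otimes> z) = p y \<otimes> p z \<otimes> com y z [^] m"
    using assms by (auto simp: centre_log_def)
  have x: "x \<in> carrier G" and xi: "x [^] j \<in> K" for j :: int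
    using K assms(2) by (auto simp: subgroup.mem_carrier subgroup_int_pow_closed)
  have "com (x [^] j) (x [^] l) = \<one>" for j l :: int
    using x by (simp add: commutator_int_pow_left commutator_int_pow_right)
  then have "group_hom integer_group G (\<lambda>j. p (x [^] j))"
    using x xi pZ
    by (auto simp: group_hom_def group_hom_axioms_def hom_def int_pow_mult p)
  from group_hom.hom_int_pow[OF this, of 1 i] show ?thesis
    using x by simp
qed

text \<open>Since \<open>K\<close> contains \<open>Z\<close>, it contains all commutators and is
  normal, so adjoining \<open>e\<close> gives the products \<open>x \<otimes> e [^] a\<close>. The
  product law dictates the new map on them once the image of \<open>e\<close> is chosen.\<close>

lemma centre_log_extend:
  assumes log: "centre_log K m p" and e: "e \<in> carrier G"
  obtains K' m' p' where "centre_log K' m' p'" "K \<subseteq> K'" "e \<in> K'"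
proof -
  have K: "subgroup K G" and ZK: "\<And>z. z \<in> Z \<Longrightarrow> z \<in> K" and m: "m > 0"
    and pZ: "\<And>x. x \<in> K \<Longrightarrow> p x \<in> Z"
    and p: "\<And>x y. \<lbrakk>x \<in> K; y \<in> K\<rbrakk> \<Longrightarrow> p (x \<otimes> y) = p x \<otimes> p y \<otimes> com x y [^] m"
    and p_Z: "\<And>z. z \<in> Z \<Longrightarrow> p z = z [^] (2 * m)"
    using log by (auto simp: centre_log_def)
  have KG: "\<And>x. x \<in> K \<Longrightarrow> x \<in> carrier G"
    using K by (simp add: subgroup.mem_carrier)
  note K1 = subgroup.one_closed[OF K] and Km = subgroup.m_closed[OF K]
    and Ki = subgroup.m_inv_closed[OF K]
  \<comment> \<open>The image of \<open>e\<close> would have to be a \<open>k\<close>-th root of \<open>p (e\<^sup>k)\<close>; passing from \<open>m\<close> to \<open>m k\<close>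
    replaces it by \<open>c\<close>.\<close>
  obtain k :: int and c where k: "k > 0" and c: "c \<in> Z"
    and kc: "\<And>n::int. e [^] n \<in> K \<Longrightarrow> p (e [^] n) [^] k = c [^] n"
  proof (cases "\<exists>k::int. k > 0 \<and> e [^] k \<in> K")
    case True
    then obtain k :: int where k: "k > 0" "e [^] k \<in> K" by blast
    \<comment> \<open>Both sides equal \<open>p (e [^] (k * n))\<close>; \<open>k\<close> need not
      be the least positive exponent.\<close>
    have "p (e [^] n) [^] k = p (e [^] k) [^] n" if "e [^] n \<in> K" for n :: int
      using centre_log_int_pow[OF log that, of k] centre_log_int_pow[OF log k(2), of n] e
      by (simp add: int_pow_pow mult.commute)
    with k show thesis by (intro that[of k "p (e [^] k)"]) (auto intro: pZ)
  next
    case False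
    \<comment> \<open>Negative exponents are excluded by inverting. Thus only \<open>n = 0\<close>
      constrains \<open>c\<close>, and the identity serves as its value.\<close>
    have n0: "n = 0" if "e [^] n \<in> K" for n :: int
      using False that Ki[OF that] e by (metis int_pow_neg neg_0_less_iff_less linorder_neqE)
    have "p (e [^] n) [^] (1::int) = \<one> [^] n" if "e [^] n \<in> K" for n :: int
      using n0[OF that] p_Z[of \<one>] by simp
    then show thesis by (intro that[of 1 \<one>]) auto
  qed
  define M where "M = m * k"
  \<comment> \<open>The value that the product law with exponent \<open>M\<close> forces on
    \<open>x \<otimes> e [^] a\<close>, when \<open>x\<close> goes to \<open>p x [^] k\<close> and
    \<open>e\<close> to \<open>c\<close>.\<close>
  define F where "F x a = p x [^] k \<otimes> c [^] a \<otimes> com x e [^] (a * M)" for x and a :: int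
  define K' where "K' = {x \<otimes> e [^] a | x (a::int). x \<in> K}"
  \<comment> \<open>Two decompositions of one element differ by a power of \<open>e\<close> lying in
    \<open>K\<close>, and there \<open>kc\<close> makes the old and new values agree.\<close>
  have F_unique: "F x a = F y b"
    if xy: "x \<in> K" "y \<in> K" and eq: "x \<otimes> e [^] a = y \<otimes> e [^] b" for x y a b
  proof -
    define n where "n = a - b"
    have x: "x \<in> carrier G" and y: "y \<in> carrier G"
      using xy KG by auto
    have yn: "y = x \<otimes> e [^] n"
      using eq x y e unfolding n_def by (simp add: int_pow_diff inv_solve_right flip: m_assoc)
    then have "e [^] n = inv x \<otimes> y"
      using x e by simp
    then have nK: "e [^] n \<in> K"
      using Km Ki xy by simp
    have a: "a = n + b" by (simp add: n_def)
    have "com y e = com x e"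
      using x e by (simp add: yn commutator_mult_left commutator_int_pow_left)
    \<comment> \<open>The commutator factor from the product law makes up for the change of exponent
      from \<open>b\<close> to \<open>a = n + b\<close> in the last factor of
      \<open>F\<close>.\<close>
    moreover have "p y [^] k = p x [^] k \<otimes> c [^] n \<otimes> com x e [^] (n * M)"
      using x e pZ xy nK
      by (simp add: yn p int_pow_distrib_Z kc commutator_int_pow_right int_pow_pow M_def mult.assoc)
    ultimately show ?thesis
      unfolding F_def a using x e pZ xy c
      by (simp add: distrib_right int_pow_mult m_assoc Z_comm Z_lcomm)
  qed
  \<comment> \<open>An arbitrary decomposition is chosen; by \<open>F_unique\<close> the value does
    not depend on it.\<close>
  define p' where "p' u = (let xa = SOME xa. fst xa \<in> K \<and> u = fst xa \<otimes> e [^] (snd xa::int)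
    in F (fst xa) (snd xa))" for u
  have p': "p' (x \<otimes> e [^] a) = F x a" if "x \<in> K" for x a
  proof -
    let ?P = "\<lambda>xa. fst xa \<in> K \<and> x \<otimes> e [^] a = fst xa \<otimes> e [^] (snd xa::int)"
    have P: "?P (Eps ?P)"
      by (rule someI[of ?P "(x, a)"]) (simp add: that)
    show ?thesis
      unfolding p'_def Let_def by (rule F_unique) (use P that in auto)
  qed
  \<comment> \<open>The commutator left by moving \<open>e [^] a\<close> past \<open>y\<close> is
    central, so it can be absorbed into the part from \<open>K\<close>.\<close>
  have collect: "x \<otimes> e [^] a \<otimes> (y \<otimes> e [^] b)
      = x \<otimes> y \<otimes> com e y [^] a \<otimes> e [^] (a + b)" if "x \<in> K" "y \<in> K" for x y and a b :: int
  proof -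
    have xy: "x \<in> carrier G" "y \<in> carrier G" using KG that by auto
    have "e [^] a \<otimes> y = y \<otimes> e [^] a \<otimes> com e y [^] a"
      using commutator_swap[of "e [^] a" y] e xy by (simp add: commutator_int_pow_left)
    then have "x \<otimes> (e [^] a \<otimes> y) \<otimes> e [^] b = x \<otimes> (y \<otimes> e [^] a \<otimes> com e y [^] a) \<otimes> e [^] b"
      by simp
    then show ?thesis
      using e xy Z_lcomm[of "com e y [^] a" "e [^] a" "e [^] b"] by (simp add: m_assoc int_pow_mult)
  qed
  have K'_I: "x \<otimes> e [^] a \<in> K'" if "x \<in> K" for x and a :: int
    using that by (auto simp: K'_def)
  have K'_sub: "subgroup K' G"
  proof (rule subgroupI)
    show "K' \<subseteq> carrier G" using KG e by (auto simp: K'_def)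
    show "K' \<noteq> {}" using K'_I K1 by blast
  next
    fix u v assume "u \<in> K'" "v \<in> K'"
    then obtain x a y b where "x \<in> K" "u = x \<otimes> e [^] (a::int)" "y \<in> K" "v = y \<otimes> e [^] (b::int)"
      by (auto simp: K'_def)
    then show "u \<otimes> v \<in> K'"
      using K'_I Km ZK KG e by (auto simp: collect)
  next
    fix u assume "u \<in> K'"
    then obtain x a where x: "x \<in> K" and u: "u = x \<otimes> e [^] (a::int)"
      by (auto simp: K'_def)
    \<comment> \<open>Padding with the identity and \<open>e [^] 0\<close> gives a product to which
      \<open>collect\<close> applies.\<close>
    have "inv u = \<one> \<otimes> e [^] (- a) \<otimes> (inv x \<otimes> e [^] (0::int))"
      using x KG e by (simp add: u inv_mult_group int_pow_neg)
    also have "\<dots> \<in> K'"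
      unfolding collect[OF K1 Ki[OF x]] using K'_I Km ZK KG e K1 Ki x by auto
    finally show "inv u \<in> K'" .
  qed
  have KK': "K \<subseteq> K'"
    using K'_I[of _ 0] KG by auto
  have "centre_log K' M p'"
    unfolding centre_log_def
  proof (intro conjI ballI image_subsetI)
    show "Z \<subseteq> K'" using ZK KK' by blast
    show "M > 0" using m k by (simp add: M_def)
  next
    fix u assume "u \<in> K'"
    then show "p' u \<in> Z"
      using pZ c KG e by (auto simp: K'_def p' F_def)
  next
    fix u v assume "u \<in> K'" "v \<in> K'"
    then obtain x a y b where xK: "x \<in> K" and u: "u = x \<otimes> e [^] (a::int)"
      and yK: "y \<in> K" and v: "v = y \<otimes> e [^] (b::int)"
      by (auto simp: K'_def)
    have x: "x \<in> carrier G" and y: "y \<in> carrier G" using KG xK yK by auto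
    define w where "w = com e y [^] a"
    have w: "w = com y e [^] (- a)"
      using e y commutator_sym[OF y e] by (simp add: w_def int_pow_inv int_pow_neg)
    have wZ: "w \<in> Z"
      using e y by (simp add: w_def)
    have com_w: "com (x \<otimes> y) w = \<one>"
      using x y wZ commutator_sym[of w "x \<otimes> y"] by simp
    \<comment> \<open>The central \<open>w\<close> contributes \<open>w [^] (2 * m)\<close>, whose
      \<open>k\<close>-th power is the last factor.\<close>
    have "p (x \<otimes> y \<otimes> w) [^] k
        = p x [^] k \<otimes> p y [^] k \<otimes> com x y [^] M \<otimes> com y e [^] (- a * (2 * M))"
      using x y e pZ xK yK wZ
      by (simp add: p Km ZK com_w p_Z int_pow_distrib_Z int_pow_pow M_def mult.assoc)
        (simp add: w int_pow_pow)
    moreover have "com (x \<otimes> y \<otimes> w) e = com x e \<otimes> com y e"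
      using x y e wZ by (simp add: commutator_mult_left)
    \<comment> \<open>Here the 2 in \<open>p z = z [^] (2 * m)\<close> is decisive: reordering
      contributes \<open>-2 a M\<close> and \<open>F\<close> contributes \<open>(a + b) M\<close>.
      The sum \<open>(b - a) M\<close> is what \<open>F y b\<close> and \<open>com u v [^] M\<close>
      supply together.\<close>
    moreover have "com y e [^] (b * M) \<otimes> com y e [^] (- a * M) = com y e [^] (- a * (2 * M)) \<otimes> com y e [^] (b * M + a * M)"
      using y e by (simp add: algebra_simps flip: int_pow_mult)
    ultimately have "F (x \<otimes> y \<otimes> w) (b + a) = p x [^] k \<otimes> p y [^] k \<otimes> com x y [^] M \<otimes> c [^] b \<otimes> c [^] a
        \<otimes> com x e [^] (b * M) \<otimes> com x e [^] (a * M) \<otimes> (com y e [^] (b * M) \<otimes> com y e [^] (- a * M))"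
      unfolding F_def using x y e pZ xK yK c
      by (simp add: int_pow_distrib_Z int_pow_mult distrib_right m_assoc Z_comm Z_lcomm)
    moreover have "p' (u \<otimes> v) = F (x \<otimes> y \<otimes> w) (b + a)"
      unfolding u v collect[OF xK yK] w_def add.commute[of b a]
      by (rule p') (use Km xK yK wZ ZK w_def in blast)
    moreover have "com u v [^] M = com x y [^] M \<otimes> com x e [^] (b * M) \<otimes> com y e [^] (- a * M)"
    proof -
      have "com u v = com x y \<otimes> com x e [^] b \<otimes> w"
        using x y e by (simp add: u v w_def commutator_mult_left commutator_mult_right
            commutator_int_pow_left commutator_int_pow_right m_assoc Z_comm Z_lcomm)
      then show ?thesis
        using x y e wZ by (simp add: int_pow_distrib_Z int_pow_pow w)
    qed
    moreover have "p' u = F x a" "p' v = F y b"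
      unfolding u v using p' xK yK by auto
    ultimately show "p' (u \<otimes> v) = p' u \<otimes> p' v \<otimes> com u v [^] M"
      using x y e pZ xK yK c
      by (simp only: F_def) (simp add: m_assoc Z_comm Z_lcomm)
  next
    fix z assume z: "z \<in> Z"
    have "p' z = F z 0"
      using p'[of z 0] ZK[OF z] z by simp
    then show "p' z = z [^] (2 * M)"
      using z c e by (simp add: F_def p_Z int_pow_pow M_def mult.assoc)
  qed (rule K'_sub)
  moreover have "e \<in> K'"
    using K'_I[OF K1, of 1] e by simp
  ultimately show thesis
    using KK' that by blast
qed

lemma centre_log_finite:
  assumes "finite A" "A \<subseteq> carrier G"
  shows "\<exists>K m p. centre_log K m p \<and> A \<subseteq> K"
  using assms
proof (induction A rule: finite_induct)
  case empty
  then show ?case using centre_log_Z by blast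
next
  case (insert e A)
  then obtain K m p where "centre_log K m p" "A \<subseteq> K" by auto
  moreover have "e \<in> carrier G" using insert by simp
  ultimately show ?case
    by (metis centre_log_extend insert_subset subset_trans)
qed

section \<open>Dilations\<close>

text \<open>
  With \<open>t = 2 m j + 1\<close> this is \<open>x\<^sup>t\<close> times the \<open>t (t - 1) / (2 m)\<close>-th power of \<open>p x\<close>. The commutators
  that \<open>p\<close> produces on a product then cancel those produced by the \<open>t\<close>-th power.
\<close>

definition dilation :: "int \<Rightarrow> ('a \<Rightarrow> 'a) \<Rightarrow> nat \<Rightarrow> 'a \<Rightarrow> 'a" where
  "dilation m p j x = (x \<otimes> p x [^] int j) [^] (2 * m * int j + 1)"

lemma dilation_hom:
  assumes "centre_log K m p"
  shows "dilation m p j \<in> hom (G\<lparr>carrier := K\<rparr>) G"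
proof (rule homI; simp)
  have K: "subgroup K G" and m: "m > 0" and pZ: "\<And>x. x \<in> K \<Longrightarrow> p x \<in> Z"
    and p: "\<And>x y. \<lbrakk>x \<in> K; y \<in> K\<rbrakk> \<Longrightarrow> p (x \<otimes> y) = p x \<otimes> p y \<otimes> com x y [^] m"
    using assms by (auto simp: centre_log_def)
  have KG: "\<And>x. x \<in> K \<Longrightarrow> x \<in> carrier G"
    using K by (simp add: subgroup.mem_carrier)
  {
    fix x assume "x \<in> K"
    then show "dilation m p j x \<in> carrier G"
      using KG pZ by (simp add: dilation_def)
  }
  fix x y assume xK: "x \<in> K" and yK: "y \<in> K"
  have x: "x \<in> carrier G" and y: "y \<in> carrier G" and px: "p x \<in> Z" and py: "p y \<in> Z"
    using KG pZ xK yK by auto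
  \<comment> \<open>\<open>n\<close> is \<open>t\<close> as a natural number, as
    \<open>power_mult_class2\<close> requires. The odd \<open>t\<close> makes
    \<open>n (n - 1) / 2\<close> equal to \<open>m j t\<close>, the exponent that the commutator
    from \<open>p\<close> acquires under the \<open>t\<close>-th power.\<close>
  define n where "n = 2 * nat m * j + 1"
  define t where "t = 2 * m * int j + 1"
  have tn: "t = int n" and half: "int (n * (n - 1) div 2) = m * int j * t"
    using m by (auto simp: t_def n_def algebra_simps)
  define X where "X = x \<otimes> p x [^] int j"
  define Y where "Y = y \<otimes> p y [^] int j"
  have X: "X \<in> carrier G" and Y: "Y \<in> carrier G"
    using x y px py by (auto simp: X_def Y_def)
  have comYX: "com Y X = inv com x y"
    unfolding X_def Y_def using x y px py
    by (simp add: commutator_mult_left commutator_mult_right commutator_sym[OF x y]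
        commutator_sym[of "p x [^] int j" y] commutator_sym[of "p x [^] int j" "p y [^] int j"])
  have "x \<otimes> y \<otimes> p (x \<otimes> y) [^] int j = X \<otimes> Y \<otimes> com x y [^] (m * int j)"
    unfolding X_def Y_def p[OF xK yK] using x y px py
      Z_lcomm[of "p x [^] int j" y "p y [^] int j \<otimes> com x y [^] (m * int j)"]
    by (simp add: int_pow_distrib_Z int_pow_pow m_assoc)
  then have "dilation m p j (x \<otimes> y) = (X \<otimes> Y \<otimes> com x y [^] (m * int j)) [^] t"
    by (simp add: dilation_def t_def)
  also have "\<dots> = (X \<otimes> Y) [^] t \<otimes> com x y [^] (m * int j * t)"
    using X Y x y by (simp add: int_pow_distrib_Z int_pow_pow)
  \<comment> \<open>The collection formula produces powers of \<open>com Y X\<close>, the inverse of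
    \<open>com x y\<close>; hence the cancellation.\<close>
  also have "(X \<otimes> Y) [^] t = X [^] t \<otimes> Y [^] t \<otimes> inv (com x y [^] (m * int j * t))"
    using power_mult_class2[OF X Y, of n] x y unfolding half comYX tn[symmetric]
    by (simp add: int_pow_inv)
  finally show "dilation m p j (x \<otimes> y) = dilation m p j x \<otimes> dilation m p j y"
    using X Y x y by (simp add: m_assoc dilation_def flip: X_def Y_def t_def)
qed

text \<open>The centre has weight 2: multiplying by \<open>p z [^] int j\<close> already turns
  \<open>z\<close> into its \<open>t\<close>-th power, and the outer power contributes a second
  factor \<open>t\<close>.\<close>

lemma dilation_central:
  assumes "centre_log K m p" "z \<in> Z"
  shows "dilation m p j z = z [^] ((2 * m * int j + 1)\<^sup>2)"
proof -
  have "z \<otimes> p z [^] int j = z [^] (1 + 2 * m * int j)"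
    using assms by (simp add: centre_log_def int_pow_pow int_pow_mult)
  then show ?thesis
    using assms by (simp add: dilation_def int_pow_pow power2_eq_square add.commute)
qed

text \<open>Modulo the centre the weight is 1, because \<open>p\<close> takes values in
  \<open>Z\<close>.\<close>

lemma dilation_mod_centre:
  assumes "centre_log K m p" "x \<in> K"
  obtains w where "w \<in> Z" "dilation m p j x = x [^] (2 * m * int j + 1) \<otimes> w"
proof (rule that)
  have px: "p x \<in> Z" and x: "x \<in> carrier G"
    using assms by (auto simp: centre_log_def subgroup.mem_carrier)
  show "(p x [^] int j) [^] (2 * m * int j + 1) \<in> Z"
    using px by (intro Z_closed)
  show "dilation m p j x = x [^] (2 * m * int j + 1) \<otimes> (p x [^] int j) [^] (2 * m * int j + 1)"
    unfolding dilation_def by (rule int_pow_distrib_Z) (use px x in simp_all)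
qed

section \<open>Torsion-freeness: dilations are injective and have distinct values\<close>

lemma torsion_free_int_pow:
  assumes "torsion_free G" "x \<in> carrier G" "x [^] (i::int) = \<one>" "i \<noteq> 0"
  shows "x = \<one>"
proof -
  have "x [^] \<bar>i\<bar> = \<one>"
    using assms(2,3) by (cases "i \<ge> 0") (simp_all add: int_pow_neg)
  then have "x [^] nat \<bar>i\<bar> = \<one>"
    by (simp flip: int_pow_int)
  moreover have "nat \<bar>i\<bar> > 0"
    using assms(4) by simp
  ultimately show ?thesis
    using assms(1,2) unfolding torsion_free_def by blast
qed

text \<open>The quotient by the centre is torsion-free as well: by bilinearity,
  \<open>com x y [^] i = com (x [^] i) y\<close> is trivial, hence so is
  \<open>com x y\<close>.\<close>

lemma torsion_free_root_of_centre:
  assumes tf: "torsion_free G" and x: "x \<in> carrier G" and i: "x [^] (i::int) \<in> Z" "i \<noteq> 0"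
  shows "x \<in> Z"
proof -
  have "y \<otimes> x = x \<otimes> y" if y: "y \<in> carrier G" for y
  proof -
    have "com x y [^] i = \<one>"
      using i x y by (simp flip: commutator_int_pow_left)
    then have "com x y = \<one>"
      using torsion_free_int_pow[OF tf _ _ i(2)] x y by simp
    then show ?thesis
      using commutator_swap[OF x y] x y by simp
  qed
  then show ?thesis
    using x unfolding centre_def by blast
qed

text \<open>Modulo \<open>Z\<close> a kernel element has trivial \<open>t\<close>-th power, so it is
  central. There the map is the power with exponent the square of \<open>t\<close>, which is
  injective at the identity.\<close>

lemma dilation_inj_on:
  assumes log: "centre_log K m p" and tf: "torsion_free G"
  shows "inj_on (dilation m p j) K"
proof -
  have K: "subgroup K G" and m: "m > 0"
    using log by (auto simp: centre_log_def)
  have t: "2 * m * int j + 1 \<noteq> 0"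
    using m by (smt (verit) mult_nonneg_nonneg of_nat_0_le_iff)
  have hom: "group_hom (G\<lparr>carrier := K\<rparr>) G (dilation m p j)"
    using subgroup_imp_group[OF K] dilation_hom[OF log]
    by (simp add: group_hom_def group_hom_axioms_def)
  have "x = \<one>" if x: "x \<in> K" and 1: "dilation m p j x = \<one>" for x
  proof -
    have xG: "x \<in> carrier G" using K x by (simp add: subgroup.mem_carrier)
    obtain w where w: "w \<in> Z" "dilation m p j x = x [^] (2 * m * int j + 1) \<otimes> w"
      using dilation_mod_centre[OF log x] .
    then have "x [^] (2 * m * int j + 1) = inv w"
      using inv_equality[of "x [^] (2 * m * int j + 1)" w] 1 xG by simp
    then have "x [^] (2 * m * int j + 1) \<in> Z"
      using w subgroup.m_inv_closed[OF subgroup_Z] by simp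
    then have "x \<in> Z"
      using torsion_free_root_of_centre[OF tf xG _ t] by blast
    then show ?thesis
      using 1 dilation_central[OF log] torsion_free_int_pow[OF tf xG] t by simp
  qed
  then show ?thesis
    using group_hom.inj_on_one_iff[OF hom] by simp
qed

text \<open>If the factors \<open>t\<close> and \<open>s\<close> give the same image, then
  \<open>g [^] (t - s)\<close> is central, hence so is \<open>g\<close>. Comparing the squared
  exponents on the centre then forces \<open>g\<close> to be trivial; positivity of \<open>t\<close>
  and \<open>s\<close> keeps their squares distinct.\<close>

lemma inj_dilation:
  assumes log: "centre_log K m p" and tf: "torsion_free G" and g: "g \<in> K" "g \<noteq> \<one>"
  shows "inj (\<lambda>j. dilation m p j g)"
proof (rule injI, rule ccontr)
  fix i j assume eq: "dilation m p i g = dilation m p j g" and ij: "i \<noteq> j"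
  have m: "m > 0" and gG: "g \<in> carrier G"
    using log g by (auto simp: centre_log_def subgroup.mem_carrier)
  define t where "t = 2 * m * int i + 1"
  define s where "s = 2 * m * int j + 1"
  have pos: "t > 0" "s > 0" and ne: "t \<noteq> s"
    using m ij by (auto simp: t_def s_def add_nonneg_pos)
  obtain v where v: "v \<in> Z" "dilation m p i g = g [^] t \<otimes> v"
    using dilation_mod_centre[OF log g(1)] unfolding t_def .
  obtain w where w: "w \<in> Z" "dilation m p j g = g [^] s \<otimes> w"
    using dilation_mod_centre[OF log g(1)] unfolding s_def .
  have z: "w \<otimes> inv v \<in> Z"
    using v w subgroup.m_inv_closed[OF subgroup_Z] by simp
  have "g [^] t \<otimes> v = g [^] s \<otimes> w" using eq v w by simp
  then have "g [^] t = g [^] s \<otimes> (w \<otimes> inv v)"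
    using v w gG by (simp add: inv_solve_right flip: m_assoc)
  also have "\<dots> = w \<otimes> inv v \<otimes> g [^] s"
    using Z_comm[OF z, of "g [^] s"] gG by simp
  finally have "g [^] (t - s) \<in> Z"
    using z gG Z_carrier[OF z] by (simp add: int_pow_diff m_assoc[OF Z_carrier[OF z]])
  then have "g \<in> Z"
    using torsion_free_root_of_centre[OF tf gG, of "t - s"] ne by simp
  then have "g [^] (t\<^sup>2 - s\<^sup>2) = \<one>"
    using eq gG dilation_central[OF log] by (simp add: int_pow_diff t_def s_def)
  moreover have "t\<^sup>2 - s\<^sup>2 \<noteq> 0"
    using pos ne by (simp add: power2_eq_iff)
  ultimately show False
    using torsion_free_int_pow[OF tf gG] g by blast
qed

end

section \<open>Formulas under injective homomorphisms\<close>

lemma tval_hom: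
  assumes "group G" "subgroup K G" "h \<in> hom (G\<lparr>carrier := K\<rparr>) G" "range e \<subseteq> K"
  shows "tval G e w \<in> K \<and> tval G (h \<circ> e) w = h (tval G e w)"
proof -
  interpret group G by fact
  interpret h: group_hom "G\<lparr>carrier := K\<rparr>" G h
    using subgroup_imp_group[OF assms(2)] assms by (simp add: group_hom_def group_hom_axioms_def)
  show ?thesis
  proof (induction w)
    case (Mult s t)
    then show ?case using h.hom_mult[of "tval G e s" "tval G e t"] subgroup.m_closed[OF assms(2)] by simp
  next
    case (Inv t)
    then show ?case
      using h.hom_inv[of "tval G e t"] subgroup.m_inv_closed[OF assms(2)] m_inv_consistent[OF assms(2)]
      by simp
  qed (use assms(4) h.hom_one subgroup.one_closed[OF assms(2)] in auto)
qed

text \<open>Without quantifiers only values of terms matter, and these stay in \<open>K\<close>.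
  Injectivity makes equations hold in both directions, which carries the equivalence through
  negations.\<close>

lemma sat_word_matrix_inj_hom:
  assumes "group G" "subgroup K G" "h \<in> hom (G\<lparr>carrier := K\<rparr>) G" "inj_on h K" "range e \<subseteq> K"
    and "word_matrix b"
  shows "sat G (h \<circ> e) b \<longleftrightarrow> sat G e b"
  using assms(6)
proof (induction b)
  case (Eq s t)
  then show ?case
    using tval_hom[OF assms(1-3,5)] inj_on_eq_iff[OF assms(4)] by (metis sat.simps(1))
qed auto

text \<open>Only the set of quantified variables matters, so repetitions in \<open>xs\<close> are
  harmless.\<close>

lemma sat_foldr_Ex:
  "sat G e (foldr Ex xs b) \<longleftrightarrow>
    (\<exists>e'. (\<forall>i\<in>set xs. e' i \<in> carrier G) \<and> (\<forall>i. i \<notin> set xs \<longrightarrow> e' i = e i) \<and> sat G e' b)"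
proof (induction xs arbitrary: e)
  case Nil
  have "(\<forall>i. e' i = e i) \<longleftrightarrow> e' = e" for e' by auto
  then show ?case by simp
next
  case (Cons x xs)
  show ?case (is "_ \<longleftrightarrow> (\<exists>e'. ?Q e')")
  proof
    assume "sat G e (foldr Ex (x # xs) b)"
    then obtain a e' where "a \<in> carrier G" "\<forall>i\<in>set xs. e' i \<in> carrier G"
      "\<forall>i. i \<notin> set xs \<longrightarrow> e' i = (e(x := a)) i" "sat G e' b"
      by (auto simp: Cons.IH)
    \<comment> \<open>If \<open>x\<close> is quantified again inside, the outer choice
      \<open>a\<close> is overwritten.\<close>
    then have "?Q e'" by (cases "x \<in> set xs") auto
    then show "\<exists>e'. ?Q e'" by (rule exI[of ?Q])
  next
    assume "\<exists>e'. ?Q e'"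
    then obtain e' where e': "?Q e'" ..
    then have "sat G (e(x := e' x)) (foldr Ex xs b)"
      unfolding Cons.IH by (intro exI[of _ e']) auto
    then show "sat G e (foldr Ex (x # xs) b)"
      using e' by auto
  qed
qed

section \<open>From local to global nilpotency class\<close>

text \<open>Centrality of commutators is a law in three elements, so it can be checked in the
  subgroup that these generate.\<close>

lemma locally_class2_imp_class2:
  fixes G (structure)
  assumes "group G" "locally_class2_nilpotent G"
  shows "class2_group G"
proof -
  interpret group G by fact
  show ?thesis
  proof
    fix x y assume x: "x \<in> carrier G" and y: "y \<in> carrier G"
    have com: "commutator G x y \<in> carrier G"
      using x y by (simp add: commutator_def)
    have "z \<otimes> commutator G x y = commutator G x y \<otimes> z" if z: "z \<in> carrier G" for z
    proof -
      define S where "S = {x, y, z}"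
      define H where "H = G\<lparr>carrier := generate G S\<rparr>"
      have S: "S \<subseteq> carrier G" "finite S" using x y z by (auto simp: S_def)
      have sub: "subgroup (generate G S) G" by (rule generate_is_subgroup[OF S(1)])
      have com_H: "commutator H a b = commutator G a b"
        if "a \<in> carrier H" "b \<in> carrier H" for a b
        using that m_inv_consistent[OF sub] by (simp add: H_def commutator_def)
      have H: "x \<in> carrier H" "y \<in> carrier H" "z \<in> carrier H"
        by (auto simp: H_def S_def intro: generate.incl)
      have xyH: "commutator G x y \<in> carrier H"
        using H subgroup.m_closed[OF sub] subgroup.m_inv_closed[OF sub]
        by (simp add: H_def commutator_def)
      \<comment> \<open>With indices from 0, index 1 is the derived subgroup and
        \<open>Suc 1\<close> the term that class 2 makes trivial.\<close>
      have "commutator G x y \<in> lower_central H 1"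
        using H com_H[of x y] by (auto intro!: generate.incl) metis
      then have "commutator H (commutator G x y) z \<in> lower_central H (Suc 1)"
        unfolding lower_central.simps(2)[of H 1] using H by (blast intro: generate.incl)
      moreover have "lower_central H (Suc 1) = {\<one>}"
        using assms(2) S by (auto simp: locally_class2_nilpotent_def nilpotent_class_le_def H_def numeral_2_eq_2)
      ultimately have "commutator G (commutator G x y) z = \<one>"
        using com_H[OF xyH H(3)] by simp
      then have "inv (z \<otimes> commutator G x y) \<otimes> (commutator G x y \<otimes> z) = \<one>"
        using com z by (simp add: commutator_def inv_mult_group m_assoc)
      then show ?thesis
        using com z by (metis inv_closed inv_equality inv_inv m_closed)
    qed
    then show "commutator G x y \<in> centre G"
      using com unfolding centre_def by blast
  qed
qed

section \<open>Conciseness\<close>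

theorem theorem1p2:
  fixes \<phi> :: gform
  assumes "one_free_var \<phi>" and "existential TYPE('a) \<phi>"
  shows "concise_in {G :: 'a monoid. group G \<and> torsion_free G \<and> locally_class2_nilpotent G} \<phi>"
  unfolding concise_in_def
proof (intro ballI impI)
  fix G :: "'a monoid" (structure)
  assume "G \<in> {G. group G \<and> torsion_free G \<and> locally_class2_nilpotent G}"
    and fin: "finite (solutions G \<phi>)"
  then have G: "group G" and tf: "torsion_free G" and "class2_group G"
    by (auto intro: locally_class2_imp_class2)
  interpret class2_group G by fact
  obtain xs b where b: "word_matrix b"
    and equiv: "logically_equivalent TYPE('a) \<phi> (foldr Ex xs b)"
    using assms(2) by (auto simp: existential_def existential_prenex_def)
  have sol: "g \<in> solutions G \<phi> \<longleftrightarrow> sat G (\<lambda>_. g) (foldr Ex xs b)" if "g \<in> carrier G" for g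
    using that equiv G by (auto simp: solutions_def logically_equivalent_def)
  have "solutions G \<phi> \<subseteq> {\<one>}"
  proof (rule ccontr)
    assume "\<not> solutions G \<phi> \<subseteq> {\<one>}"
    then obtain g where g: "g \<in> solutions G \<phi>" "g \<noteq> \<one>" "g \<in> carrier G"
      by (auto simp: solutions_def)
    then obtain e where eG: "\<forall>i\<in>set xs. e i \<in> carrier G" and eg: "\<forall>i. i \<notin> set xs \<longrightarrow> e i = g"
      and eb: "sat G e b"
      using sol by (auto simp: sat_foldr_Ex)
    \<comment> \<open>The witness assignment is \<open>g\<close> off \<open>xs\<close>, so it takes
      finitely many values and a single subgroup \<open>K\<close> contains them all.\<close>
    have "range e \<subseteq> insert g (e ` set xs)" using eg by auto
    then have "finite (insert g (range e))" "insert g (range e) \<subseteq> carrier G"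
      using eG g(3) by (auto intro: finite_subset)
    then obtain K m p where log: "centre_log K m p" and K: "range e \<subseteq> K" "g \<in> K"
      using centre_log_finite by (metis insert_subset)
    have sub: "subgroup K G" using log by (simp add: centre_log_def)
    have "dilation m p j g \<in> solutions G \<phi>" for j
    proof -
      have hG: "dilation m p j x \<in> carrier G" if "x \<in> K" for x
        using dilation_hom[OF log] that by (auto simp: hom_def)
      have "sat G (dilation m p j \<circ> e) b"
        using sat_word_matrix_inj_hom[OF G sub dilation_hom[OF log] dilation_inj_on[OF log tf] K(1) b] eb
        by blast
      \<comment> \<open>Off \<open>xs\<close> the dilated assignment is constantly the image of
        \<open>g\<close>, so it supplies witnesses for that image.\<close>
      then have "sat G (\<lambda>_. dilation m p j g) (foldr Ex xs b)"
        unfolding sat_foldr_Ex using eg hG range_subsetD[OF K(1)]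
        by (intro exI[of _ "dilation m p j \<circ> e"]) auto
      then show ?thesis
        using sol hG K(2) by blast
    qed
    then have "range (\<lambda>j. dilation m p j g) \<subseteq> solutions G \<phi>" by blast
    then show False
      using fin inj_dilation[OF log tf K(2) g(2)] finite_subset range_inj_infinite by blast
  qed
  then have "generate G (solutions G \<phi>) \<subseteq> {\<one>}"
    using generate_subgroup_incl[OF _ triv_subgroup] by blast
  then show "finite (formula_subgroup G \<phi>)"
    unfolding formula_subgroup_def by (rule finite_subset) simp
qed

end
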